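(* Let $k\ge1$ and consider the Markov chain (the Harmonic Chain) on states $\{0,1,\dots,k\}$ in which state $0$ is absorbing and from each state $\ell\in\{1,\dots,k\}$ the chain moves to $\ell-1$ with probability $\frac1k$, to $\ell+1$ with probability $\frac{k-\ell}{k}$, and stays at $\ell$ with the remaining probability $1-\frac1k-\frac{k-\ell}{k}$. Let $h(\ell)=\mathbb{E}[N\mid X_0=\ell]$, where $N=\min\{\tau\ge0: X_\tau=0\}$. Then for every $\ell\in\{0,1,\dots,k\}$, $$h(\ell)=k\sum_{i=k-\ell+1}^{k}\alpha_i,$$ where $\alpha_1=1$ and $\alpha_i=1+(i-1)\alpha_{i-1}$ for $i>1$ (the sum is empty, hence $0$, for $\ell=0$).
   Context: $(X_\tau)_{\tau\ge0}$ denotes the Markov chain described in the claim; $h(\ell)$ is its expected absorption (extinction) time from state $\ell$. *)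

theory Defs
  imports "HOL-Probability.Probability"
begin

text \<open>
  A time-homogeneous discrete-time Markov chain on the countable state space \<open>S\<close> with one-step
  transition probabilities \<open>P\<close>. The underlying probability space and the distribution of
  \<open>X 0\<close> are arbitrary.
\<close>

locale discrete_markov_chain = prob_space M
  for M :: "'a measure" and S :: "'s set" and P :: "'s \<Rightarrow> 's \<Rightarrow> real"
    and X :: "nat \<Rightarrow> 'a \<Rightarrow> 's" +
  assumes countable_states: "countable S"
    and random_states: "\<And>t. X t \<in> measurable M (count_space S)"
    and markov_property:
      "\<And>t x. (\<And>i. i \<le> Suc t \<Longrightarrow> x i \<in> S) \<Longrightarrow>
         \<P>(\<omega> in M. \<forall>i\<le>t. X i \<omega> = x i) > 0 \<Longrightarrow>
         \<P>(\<omega> in M. X (Suc t) \<omega> = x (Suc t) \<bar> \<forall>i\<le>t. X i \<omega> = x i) = P (x t) (x (Suc t))"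

definition harmonic_trans :: "nat \<Rightarrow> nat \<Rightarrow> nat \<Rightarrow> real" where
  "harmonic_trans k l m =
     (if l = 0 then (if m = 0 then 1 else 0)
      else if m = l - 1 then 1 / real k
      else if m = l + 1 then (real k - real l) / real k
      else if m = l then 1 - 1 / real k - (real k - real l) / real k
      else 0)"

lemma harmonic_trans_nonneg:
  assumes "1 \<le> k" "l \<le> k"
  shows "0 \<le> harmonic_trans k l m"
  using assms by (auto simp: harmonic_trans_def field_simps)

lemma harmonic_trans_sum:
  assumes "1 \<le> k" "l \<le> k"
  shows "(\<Sum>m\<le>k. harmonic_trans k l m) = 1"
proof (cases "l = 0")
  case True
  then show ?thesis
    by (simp add: harmonic_trans_def)
next
  case False
  have eq: "harmonic_trans k l m =
      (if m = l - 1 then 1 / real k else 0) +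
      (if m = l + 1 then (real k - real l) / real k else 0) +
      (if m = l then 1 - 1 / real k - (real k - real l) / real k else 0)" for m
    using False by (auto simp: harmonic_trans_def)
  have "l - 1 \<le> k" "l + 1 \<le> k \<or> l = k"
    using assms by auto
  then show ?thesis
    unfolding eq sum.distrib using assms by auto
qed

locale harmonic_chain = discrete_markov_chain M "{0..k}" "harmonic_trans k" X
  for M :: "'a measure" and k :: nat and X :: "nat \<Rightarrow> 'a \<Rightarrow> nat" +
  assumes k_ge_1: "1 \<le> k"

text \<open>The infimum of the empty set is \<open>\<infinity>\<close>: a path that never reaches 0 has infinite absorption time.\<close>

definition absorption_time :: "(nat \<Rightarrow> 'a \<Rightarrow> nat) \<Rightarrow> 'a \<Rightarrow> enat" where
  "absorption_time X \<omega> = Inf {enat t |t. X t \<omega> = 0}"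

text \<open>
  The expectation of the absorption time conditioned on the event \<open>X 0 = l\<close>, with values in
  \<open>[0, \<infinity>]\<close>. It is meaningful when that event has positive probability.
\<close>

definition expected_absorption_time ::
    "'a measure \<Rightarrow> (nat \<Rightarrow> 'a \<Rightarrow> nat) \<Rightarrow> nat \<Rightarrow> ennreal" where
  "expected_absorption_time M X l =
     (\<integral>\<^sup>+\<omega>. ennreal_of_enat (absorption_time X \<omega>) \<partial>uniform_measure M {\<omega> \<in> space M. X 0 \<omega> = l})"

text \<open>The value at 0 is a dummy; the recursion starts at index 1.\<close>

fun alpha :: "nat \<Rightarrow> real" where
  "alpha 0 = 0"
| "alpha (Suc 0) = 1"
| "alpha (Suc (Suc n)) = 1 + real (Suc n) * alpha (Suc n)"

end

theory Submission
  imports Defs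
begin

text \<open>
  Write \<open>H m\<close> for the claimed value at \<open>m\<close>. The recursion for \<open>alpha\<close> says exactly that \<open>H\<close>
  decreases by 1 on average in each step from a nonzero state. Hence, with \<open>u t\<close> the probability
  that the chain starts in \<open>l\<close> and has not been absorbed up to time \<open>t\<close>, and \<open>v t\<close> the integral
  of \<open>H (X t)\<close> over that event, \<open>v (Suc t) = v t - u t\<close>. So \<open>u\<close> is summable, which forces
  \<open>u \<longlonglongrightarrow> 0\<close> and, as \<open>H\<close> is bounded, \<open>v \<longlonglongrightarrow> 0\<close>. Telescoping gives \<open>(\<Sum>t. u t) = v 0\<close>, and the
  expected absorption time is \<open>(\<Sum>t. u t)\<close> divided by the probability of starting in \<open>l\<close>.
\<close>

section \<open>The claimed values and their drift\<close>

lemma alpha_Suc: "alpha (Suc n) = 1 + real n * alpha n"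
  \<comment> \<open>For \<open>n = 0\<close> the dummy \<open>alpha 0\<close> is multiplied by 0, so
    the recursion also covers \<open>alpha 1 = 1\<close>.\<close>
  by (cases n) auto

lemma alpha_nonneg: "0 \<le> alpha n"
  by (induction n rule: alpha.induct) auto

text \<open>The function called \<open>H\<close> above.\<close>

definition alpha_tail :: "nat \<Rightarrow> nat \<Rightarrow> real" where
  "alpha_tail k m = real k * (\<Sum>i\<in>{k - m + 1..k}. alpha i)"

lemma alpha_tail_0 [simp]: "alpha_tail k 0 = 0"
  by (simp add: alpha_tail_def)

lemma alpha_tail_nonneg: "0 \<le> alpha_tail k m"
  by (simp add: alpha_tail_def sum_nonneg alpha_nonneg)

text \<open>Every index set lies in \<open>{1..k}\<close>, also for \<open>m > k\<close>, where
  \<open>k - m\<close> truncates to 0. This is the bound on \<open>H\<close> that carries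
  \<open>u\<close> tending to 0 over to \<open>v\<close>.\<close>

lemma alpha_tail_le: "alpha_tail k m \<le> alpha_tail k k"
  unfolding alpha_tail_def
  by (intro mult_left_mono sum_mono2) (auto simp: alpha_nonneg)

lemma alpha_tail_Suc:
  assumes "m < k"
  shows "alpha_tail k (Suc m) = alpha_tail k m + real k * alpha (k - m)"
proof -
  have "{k - Suc m + 1..k} = insert (k - m) {k - m + 1..k}"
    using assms by auto
  then show ?thesis
    by (simp add: alpha_tail_def algebra_simps)
qed

text \<open>A step down has weight \<open>1 / k\<close> and loses
  \<open>k * alpha (k - j + 1)\<close>; a step up has weight \<open>(k - j) / k\<close> and gains
  \<open>k * alpha (k - j)\<close>. By the recursion the mean change is -1.\<close>

lemma harmonic_trans_alpha_tail:
  assumes "1 \<le> j" "j \<le> k"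
  shows "(\<Sum>m\<in>{1..k}. harmonic_trans k j m * alpha_tail k m) = alpha_tail k j - 1"
proof -
  obtain i where j: "j = Suc i"
    using assms by (cases j) auto
  have eq: "harmonic_trans k j m * alpha_tail k m =
      (if m = i then 1 / real k * alpha_tail k m else 0) +
      (if m = Suc j then (real k - real j) / real k * alpha_tail k m else 0) +
      (if m = j then (1 - 1 / real k - (real k - real j) / real k) * alpha_tail k m else 0)" for m
    using j by (auto simp: harmonic_trans_def)
  have down: "alpha_tail k j = alpha_tail k i + real k * alpha (Suc (k - j))"
    using alpha_tail_Suc[of i k] assms j by (simp add: Suc_diff_Suc)
  \<comment> \<open>State 0 contributes nothing since \<open>alpha_tail k 0 = 0\<close>; including
    it puts the predecessor \<open>i\<close> in the range also for \<open>j = 1\<close>.\<close>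
  have "(\<Sum>m\<in>{1..k}. harmonic_trans k j m * alpha_tail k m) =
      (\<Sum>m\<in>{..k}. harmonic_trans k j m * alpha_tail k m)"
    by (intro sum.mono_neutral_left) (auto simp: not_le)
  also have "\<dots> = 1 / real k * alpha_tail k i
      + (if j < k then (real k - real j) / real k * alpha_tail k (Suc j) else 0)
      + (1 - 1 / real k - (real k - real j) / real k) * alpha_tail k j"
    unfolding eq sum.distrib using assms j by (auto simp: Suc_le_eq)
  also have "\<dots> = alpha_tail k j - 1"
  proof (cases "j < k")
    case True
    have k: "real k > 0" and r: "real (k - j) = real k - real j"
      using assms by (auto simp: of_nat_diff)
    have up: "alpha_tail k (Suc j) = alpha_tail k j + real k * alpha (k - j)"
      using alpha_tail_Suc[OF True] .
    show ?thesis
      using True k unfolding up down alpha_Suc r by (simp add: field_simps)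
  next
    \<comment> \<open>Here \<open>j = k\<close>: the weight upwards is 0, and the step down loses
      \<open>k * alpha 1 = k\<close>.\<close>
    case False
    then show ?thesis
      using assms unfolding down by (simp add: field_simps)
  qed
  finally show ?thesis .
qed

section \<open>The Markov property for events of the past\<close>

context discrete_markov_chain
begin

lemma measurable_state_at [measurable]: "Measurable.pred M (\<lambda>\<omega>. X t \<omega> = x)"
proof -
  have "(\<lambda>\<omega>. X t \<omega>) \<in> measurable M (count_space S)"
    by (rule random_states)
  moreover have "(\<lambda>s. s = x) \<in> measurable (count_space S) (count_space UNIV)"
    by simp
  ultimately show ?thesis
    by (rule measurable_compose)
qed

lemma state_in:
  assumes "\<omega> \<in> space M"
  shows "X t \<omega> \<in> S"
  using measurable_space[OF random_states assms] by simp

text \<open>The Markov property in product form extends to null histories, where both sides vanish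
  by monotonicity.\<close>

lemma prob_path_Suc:
  assumes "\<And>i. i \<le> Suc t \<Longrightarrow> x i \<in> S"
  shows "\<P>(\<omega> in M. (\<forall>i\<le>t. X i \<omega> = x i) \<and> X (Suc t) \<omega> = x (Suc t)) =
    \<P>(\<omega> in M. \<forall>i\<le>t. X i \<omega> = x i) * P (x t) (x (Suc t))"
proof (cases "\<P>(\<omega> in M. \<forall>i\<le>t. X i \<omega> = x i) > 0")
  case True
  then show ?thesis
    using markov_property[OF assms True]
    by (simp add: cond_prob_def nonzero_divide_eq_eq conj_commute)
next
  case False
  then have 0: "\<P>(\<omega> in M. \<forall>i\<le>t. X i \<omega> = x i) = 0"
    by (simp add: zero_less_measure_iff)
  have "\<P>(\<omega> in M. (\<forall>i\<le>t. X i \<omega> = x i) \<and> X (Suc t) \<omega> = x (Suc t)) \<le>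
      \<P>(\<omega> in M. \<forall>i\<le>t. X i \<omega> = x i)"
    by (rule finite_measure_mono) auto
  then show ?thesis
    using 0 by (simp add: measure_le_0_iff)
qed

text \<open>With \<open>S\<close> finite, the event splits into finitely many disjoint path events
  ending in \<open>j\<close>, each of which gains the same factor \<open>P j m\<close>. Restricting
  to \<open>{..t}\<close> makes \<open>Q\<close> a condition on the past alone.\<close>

lemma prob_history_Suc:
  assumes S: "finite S" and jm: "j \<in> S" "m \<in> S"
  shows "\<P>(\<omega> in M. Q (restrict (\<lambda>i. X i \<omega>) {..t}) \<and> X t \<omega> = j \<and> X (Suc t) \<omega> = m) =
    \<P>(\<omega> in M. Q (restrict (\<lambda>i. X i \<omega>) {..t}) \<and> X t \<omega> = j) * P j m"
proof -
  define F where "F = {x \<in> {..t} \<rightarrow>\<^sub>E S. Q x \<and> x t = j}"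
  have F: "finite F"
    unfolding F_def by (intro finite_subset[OF _ finite_PiE[of "{..t}" "\<lambda>_. S"]]) (use S in auto)
  define B where "B \<omega> \<longleftrightarrow> Q (restrict (\<lambda>i. X i \<omega>) {..t}) \<and> X t \<omega> = j" for \<omega>
  have mem: "restrict (\<lambda>i. X i \<omega>) {..t} \<in> F"
    if "\<omega> \<in> space M" "B \<omega>" for \<omega>
    using that state_in by (auto simp: F_def B_def)
  \<comment> \<open>Members of \<open>F\<close> are extensional, so a sample point follows at most
    one of them; this gives disjointness.\<close>
  have restr: "x = restrict (\<lambda>i. X i \<omega>) {..t}" if "x \<in> F" "\<forall>i\<le>t. X i \<omega> = x i" for x \<omega>
    using that by (auto simp: F_def PiE_def extensional_def restrict_def)
  have disj: "x = y" if "x \<in> F" "y \<in> F" "\<forall>i\<le>t. X i \<omega> = x i" "\<forall>i\<le>t. X i \<omega> = y i" for x y \<omega>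
    using restr[OF that(1,3)] restr[OF that(2,4)] by simp
  have B: "B \<omega> \<longleftrightarrow> (\<exists>x\<in>F. \<forall>i\<le>t. X i \<omega> = x i)"
    if "\<omega> \<in> space M" for \<omega>
  proof
    assume "B \<omega>"
    then show "\<exists>x\<in>F. \<forall>i\<le>t. X i \<omega> = x i"
      using mem[OF that] by (intro bexI[of _ "restrict (\<lambda>i. X i \<omega>) {..t}"]) auto
  next
    assume "\<exists>x\<in>F. \<forall>i\<le>t. X i \<omega> = x i"
    then obtain x where x: "x \<in> F" "\<forall>i\<le>t. X i \<omega> = x i"
      by blast
    from x(2) have "X t \<omega> = x t"
      by simp
    with x(1) show "B \<omega>"
      unfolding B_def restr[OF x, symmetric] by (simp add: F_def)
  qed
  have split: "\<P>(\<omega> in M. B \<omega> \<and> R \<omega>) =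
      (\<Sum>x\<in>F. \<P>(\<omega> in M. (\<forall>i\<le>t. X i \<omega> = x i) \<and> R \<omega>))"
    if [measurable]: "Measurable.pred M R" for R
  proof -
    have "{\<omega> \<in> space M. B \<omega> \<and> R \<omega>} =
        (\<Union>x\<in>F. {\<omega> \<in> space M. (\<forall>i\<le>t. X i \<omega> = x i) \<and> R \<omega>})"
      using B by blast
    moreover have "disjoint_family_on (\<lambda>x. {\<omega> \<in> space M. (\<forall>i\<le>t. X i \<omega> = x i) \<and> R \<omega>}) F"
      unfolding disjoint_family_on_def by (auto dest: disj)
    ultimately show ?thesis
      using F by (simp add: finite_measure_finite_Union image_subset_iff)
  qed
  have "\<P>(\<omega> in M. (\<forall>i\<le>t. X i \<omega> = x i) \<and> X (Suc t) \<omega> = m) =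
      \<P>(\<omega> in M. \<forall>i\<le>t. X i \<omega> = x i) * P j m" if "x \<in> F" for x
  proof -
    \<comment> \<open>Paths in \<open>F\<close> are \<open>undefined\<close> after time
      \<open>t\<close>, so the next state \<open>m\<close> is filled in.\<close>
    have "(x(Suc t := m)) i \<in> S" if "i \<le> Suc t" for i
      using that \<open>x \<in> F\<close> jm by (auto simp: F_def le_Suc_eq)
    from prob_path_Suc[of t "x(Suc t := m)", OF this] \<open>x \<in> F\<close> show ?thesis
      by (simp add: F_def cong: conj_cong imp_cong)
  qed
  then show ?thesis
    using split[of "\<lambda>\<omega>. X (Suc t) \<omega> = m"] split[of "\<lambda>_. True"]
    by (simp add: sum_distrib_right B_def)
qed

end

section \<open>The absorption time through its tail events\<close>

lemma enat_eq_iff_less: "a = b \<longleftrightarrow> (\<forall>t. enat t < a \<longleftrightarrow> enat t < b)"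
proof (intro iffI)
  assume *: "\<forall>t. enat t < a \<longleftrightarrow> enat t < b"
  \<comment> \<open>If \<open>a < b\<close>, then \<open>a\<close> is finite, say
    \<open>enat t\<close>, and this \<open>t\<close> violates the equivalence.\<close>
  have "\<not> a < b"
    using * by (cases a) auto
  moreover have "\<not> b < a"
    using * by (cases b) auto
  ultimately show "a = b"
    by simp
qed simp

lemma less_absorption_time_iff: "enat t < absorption_time X \<omega> \<longleftrightarrow> (\<forall>i\<le>t. X i \<omega> \<noteq> 0)"
proof
  assume less: "enat t < absorption_time X \<omega>"
  show "\<forall>i\<le>t. X i \<omega> \<noteq> 0"
  proof (intro allI impI notI)
    fix i assume "i \<le> t" "X i \<omega> = 0"
    then have "absorption_time X \<omega> \<le> enat i"
      unfolding absorption_time_def by (intro Inf_lower) auto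
    also have "\<dots> \<le> enat t"
      using \<open>i \<le> t\<close> by simp
    finally show False
      using less by simp
  qed
next
  assume "\<forall>i\<le>t. X i \<omega> \<noteq> 0"
  \<comment> \<open>Every visit to 0 happens at time \<open>Suc t\<close> or later; with no visit at
    all the infimum is infinite.\<close>
  then have "enat (Suc t) \<le> absorption_time X \<omega>"
    unfolding absorption_time_def by (intro Inf_greatest) (auto simp: not_less_eq_eq[symmetric])
  then show "enat t < absorption_time X \<omega>"
    by (metis enat_ord_simps(2) lessI less_le_trans)
qed

section \<open>Survival and absorption in the harmonic chain\<close>

context harmonic_chain
begin

text \<open>\<open>enat\<close> is countable, and each level set is determined by countably many
  tail events.\<close>

lemma measurable_absorption_time [measurable]: "absorption_time X \<in> measurable M (count_space UNIV)"
proof -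
  have "Measurable.pred M (\<lambda>\<omega>. enat t < absorption_time X \<omega>)" for t
    unfolding less_absorption_time_iff by measurable
  moreover have "absorption_time X \<omega> = n \<longleftrightarrow> (\<forall>t. enat t < absorption_time X \<omega> \<longleftrightarrow> enat t < n)" for \<omega> n
    by (rule enat_eq_iff_less)
  ultimately have "Measurable.pred M (\<lambda>\<omega>. absorption_time X \<omega> = n)" for n
    by simp
  then show ?thesis
    by (auto simp: measurable_count_space_eq_countable pred_def vimage_def Int_def conj_commute)
qed

text \<open>A joint probability, not conditioned on the start; the normalisation comes at the very
  end.\<close>

definition surviving :: "nat \<Rightarrow> nat \<Rightarrow> nat \<Rightarrow> real" where
  "surviving l t j = \<P>(\<omega> in M. X 0 \<omega> = l \<and> (\<forall>i\<le>t. X i \<omega> \<noteq> 0) \<and> X t \<omega> = j)"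

lemma prob_eq_sum_nonzero_states:
  assumes [measurable]: "Measurable.pred M R"
    and "\<And>\<omega>. \<omega> \<in> space M \<Longrightarrow> R \<omega> \<Longrightarrow> X t \<omega> \<noteq> 0"
  shows "\<P>(\<omega> in M. R \<omega>) = (\<Sum>j\<in>{1..k}. \<P>(\<omega> in M. R \<omega> \<and> X t \<omega> = j))"
proof -
  have "X t \<omega> \<in> {1..k}" if "\<omega> \<in> space M" "R \<omega>" for \<omega>
    using state_in[OF that(1), of t] assms(2)[OF that] by auto
  then have "{\<omega> \<in> space M. R \<omega>} = (\<Union>j\<in>{1..k}. {\<omega> \<in> space M. R \<omega> \<and> X t \<omega> = j})"
    by blast
  moreover have "disjoint_family_on (\<lambda>j. {\<omega> \<in> space M. R \<omega> \<and> X t \<omega> = j}) {1..k}"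
    by (auto simp: disjoint_family_on_def)
  ultimately show ?thesis
    by (simp add: finite_measure_finite_Union image_subset_iff)
qed

text \<open>The forward equation of the chain killed at 0: as \<open>m\<close> is nonzero, survival
  up to \<open>Suc t\<close> follows from survival up to \<open>t\<close>, and the state at time
  \<open>t\<close> is summed out.\<close>

lemma surviving_Suc:
  assumes "m \<in> {1..k}"
  shows "surviving l (Suc t) m = (\<Sum>j\<in>{1..k}. surviving l t j * harmonic_trans k j m)"
proof -
  have "surviving l (Suc t) m =
      \<P>(\<omega> in M. (X 0 \<omega> = l \<and> (\<forall>i\<le>t. X i \<omega> \<noteq> 0)) \<and> X (Suc t) \<omega> = m)"
    unfolding surviving_def using assms
    by (intro arg_cong[of _ _ prob] Collect_cong) (auto simp: le_Suc_eq)
  also have "\<dots> = (\<Sum>j\<in>{1..k}. \<P>(\<omega> in M.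
      ((X 0 \<omega> = l \<and> (\<forall>i\<le>t. X i \<omega> \<noteq> 0)) \<and> X (Suc t) \<omega> = m) \<and> X t \<omega> = j))"
  proof (rule prob_eq_sum_nonzero_states)
    show "Measurable.pred M (\<lambda>\<omega>. (X 0 \<omega> = l \<and> (\<forall>i\<le>t. X i \<omega> \<noteq> 0)) \<and> X (Suc t) \<omega> = m)"
      by measurable
  qed blast
  also have "\<dots> = (\<Sum>j\<in>{1..k}. surviving l t j * harmonic_trans k j m)"
  proof (rule sum.cong)
    fix j assume "j \<in> {1..k}"
    then show "\<P>(\<omega> in M. ((X 0 \<omega> = l \<and> (\<forall>i\<le>t. X i \<omega> \<noteq> 0)) \<and> X (Suc t) \<omega> = m) \<and> X t \<omega> = j) =
        surviving l t j * harmonic_trans k j m"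
      using prob_history_Suc[of j m "\<lambda>x. x 0 = l \<and> (\<forall>i\<le>t. x i \<noteq> 0)" t] assms
      by (simp add: surviving_def conj_ac cong: conj_cong imp_cong)
  qed simp
  finally show ?thesis .
qed

lemma surviving_nonneg: "0 \<le> surviving l t j"
  by (simp add: surviving_def)

lemma surviving_sums:
  assumes "l \<in> {0..k}"
  shows "(\<lambda>t. \<P>(\<omega> in M. X 0 \<omega> = l \<and> (\<forall>i\<le>t. X i \<omega> \<noteq> 0))) sums
    (\<P>(\<omega> in M. X 0 \<omega> = l) * alpha_tail k l)"
proof -
  define u where "u t = (\<Sum>j\<in>{1..k}. surviving l t j)" for t
  define v where "v t = (\<Sum>j\<in>{1..k}. surviving l t j * alpha_tail k j)" for t
  have u: "\<P>(\<omega> in M. X 0 \<omega> = l \<and> (\<forall>i\<le>t. X i \<omega> \<noteq> 0)) = u t" for t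
    using prob_eq_sum_nonzero_states[of "\<lambda>\<omega>. X 0 \<omega> = l \<and> (\<forall>i\<le>t. X i \<omega> \<noteq> 0)" t]
    by (simp add: u_def surviving_def conj_assoc del: neq0_conv)
  have u_nonneg: "0 \<le> u t" for t
    unfolding u_def by (intro sum_nonneg surviving_nonneg)
  have v_nonneg: "0 \<le> v t" for t
    unfolding v_def by (intro sum_nonneg mult_nonneg_nonneg surviving_nonneg alpha_tail_nonneg)
  have v_le: "v t \<le> u t * alpha_tail k k" for t
    unfolding u_def v_def sum_distrib_right
    by (intro sum_mono mult_left_mono surviving_nonneg alpha_tail_le)
  have v_Suc: "v (Suc t) = v t - u t" for t
  proof -
    have "v (Suc t) =
        (\<Sum>m\<in>{1..k}. \<Sum>j\<in>{1..k}. surviving l t j * (harmonic_trans k j m * alpha_tail k m))"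
      unfolding v_def by (intro sum.cong) (simp_all add: surviving_Suc sum_distrib_right mult.assoc)
    \<comment> \<open>Swapping the sums isolates the mean of \<open>H\<close> after one step from
      \<open>j\<close>, to which the drift identity applies.\<close>
    also have "\<dots> =
        (\<Sum>j\<in>{1..k}. surviving l t j * (\<Sum>m\<in>{1..k}. harmonic_trans k j m * alpha_tail k m))"
      by (subst sum.swap) (simp add: sum_distrib_left)
    also have "\<dots> = (\<Sum>j\<in>{1..k}. surviving l t j * (alpha_tail k j - 1))"
      by (intro sum.cong) (simp_all add: harmonic_trans_alpha_tail[simplified])
    finally show ?thesis
      by (simp add: u_def v_def right_diff_distrib sum_subtractf)
  qed
  have partial: "(\<Sum>t<n. u t) = v 0 - v n" for n
    by (induction n) (auto simp: v_Suc)
  have "summable u"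
    \<comment> \<open>The partial sums \<open>v 0 - v n\<close> are at most \<open>v 0\<close>
      because \<open>v n\<close> is nonnegative.\<close>
    using u_nonneg v_nonneg by (intro summableI_nonneg_bounded[of _ "v 0"]) (auto simp: partial)
  then have "u \<longlonglongrightarrow> 0"
    by (rule summable_LIMSEQ_zero)
  then have "(\<lambda>t. u t * alpha_tail k k) \<longlonglongrightarrow> 0"
    by (rule tendsto_mult_left_zero)
  then have "v \<longlonglongrightarrow> 0"
    by (rule tendsto_sandwich[rotated 3]) (auto simp: v_nonneg v_le)
  then have "(\<lambda>n. v 0 - v n) \<longlonglongrightarrow> v 0 - 0"
    by (intro tendsto_intros)
  then have "u sums v 0"
    by (simp add: sums_def partial)
  moreover have "v 0 = \<P>(\<omega> in M. X 0 \<omega> = l) * alpha_tail k l"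
  proof -
    have "surviving l 0 j * alpha_tail k j =
        (if j = l then \<P>(\<omega> in M. X 0 \<omega> = l) * alpha_tail k l else 0)" if "j \<in> {1..k}" for j
    proof (cases "j = l")
      case True
      then show ?thesis
        using that by (auto simp: surviving_def intro!: arg_cong[of _ _ prob])
    next
      case False
      then have "{\<omega> \<in> space M. X 0 \<omega> = l \<and> (\<forall>i\<le>0. X i \<omega> \<noteq> 0) \<and> X 0 \<omega> = j} = {}"
        by auto
      then show ?thesis
        using False unfolding surviving_def by (simp only: measure_empty) simp
    qed
    then have "v 0 = (\<Sum>j\<in>{1..k}. if j = l then \<P>(\<omega> in M. X 0 \<omega> = l) * alpha_tail k l else 0)"
      unfolding v_def by (intro sum.cong) auto
    \<comment> \<open>For \<open>l = 0\<close> no index matches and the sum is 0, in agreement with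
      \<open>alpha_tail k 0 = 0\<close>.\<close>
    then show ?thesis
      using assms by (auto simp: not_le)
  qed
  ultimately show ?thesis
    unfolding u by simp
qed

text \<open>The expectation of an \<open>enat\<close>-valued variable is the sum of its tail
  probabilities; under the conditioned measure these are \<open>u t / p\<close>.\<close>

lemma expected_absorption_time_eq:
  assumes l: "l \<in> {0..k}" and pos: "\<P>(\<omega> in M. X 0 \<omega> = l) > 0"
  shows "expected_absorption_time M X l = ennreal (alpha_tail k l)"
proof -
  define p where "p = \<P>(\<omega> in M. X 0 \<omega> = l)"
  define A where "A = {\<omega> \<in> space M. X 0 \<omega> = l}"
  define u where "u t = \<P>(\<omega> in M. X 0 \<omega> = l \<and> (\<forall>i\<le>t. X i \<omega> \<noteq> 0))" for t
  have p: "p > 0" and A [measurable]: "A \<in> sets M"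
    using pos by (auto simp: p_def A_def)
  have "(\<lambda>t. u t / p) sums (p * alpha_tail k l / p)"
    using surviving_sums[OF l] unfolding p_def u_def by (rule sums_divide)
  then have sums: "(\<lambda>t. u t / p) sums alpha_tail k l"
    using p by simp
  have "expected_absorption_time M X l =
      (\<Sum>t. emeasure (uniform_measure M A) {\<omega> \<in> space (uniform_measure M A). t < absorption_time X \<omega>})"
    unfolding expected_absorption_time_def A_def[symmetric]
    by (rule nn_integral_enat_function) simp
  also have "\<dots> = (\<Sum>t. ennreal (u t / p))"
  proof (intro suminf_cong)
    fix t
    have "A \<inter> {\<omega> \<in> space M. enat t < absorption_time X \<omega>} =
        {\<omega> \<in> space M. X 0 \<omega> = l \<and> (\<forall>i\<le>t. X i \<omega> \<noteq> 0)}"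
      by (auto simp: A_def less_absorption_time_iff)
    then show "emeasure (uniform_measure M A)
        {\<omega> \<in> space (uniform_measure M A). enat t < absorption_time X \<omega>} = ennreal (u t / p)"
      using p by (simp add: emeasure_eq_measure u_def p_def A_def divide_ennreal)
  qed
  also have "\<dots> = ennreal (alpha_tail k l)"
    using sums by (intro sums_unique[symmetric] sums_ennreal[THEN iffD2]) (auto simp: u_def p_def alpha_tail_nonneg)
  finally show ?thesis .
qed

end

theorem theorem3:
  fixes M :: "'a measure" and X :: "nat \<Rightarrow> 'a \<Rightarrow> nat" and k l :: nat
  assumes "harmonic_chain M k X"
    and "l \<in> {0..k}"
    and "\<P>(\<omega> in M. X 0 \<omega> = l) > 0"
  shows "expected_absorption_time M X l = ennreal (real k * (\<Sum>i\<in>{k - l + 1..k}. alpha i))"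
  using harmonic_chain.expected_absorption_time_eq[OF assms] by (simp add: alpha_tail_def)

end
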